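(* For every $p\in\theta\mathbb{K}$, $$M^{p}=\{f\in\mathbb{K}\langle z\rangle : p\in \mathrm{cl}_{\theta\mathbb{K}}(\eta_{\mathbb{K}}(Z_f))\}.$$
   Context: $\mathbb{K}\langle z\rangle$ denotes any one of the following three rings: (1) the ring $\mathbb{C}\langle z\rangle$ of complex entire functions of one variable; (2) the ring $\mathbb{C}\langle x\rangle$ of convergent power series $\sum_{n\ge 0}a_nz^n$ in one complex variable $z\in\mathbb{C}$ with real coefficients $a_n\in\mathbb{R}$; (3) the ring $\mathbb{R}\langle x\rangle$ of real analytic functions of one real variable (functions on $\mathbb{R}$ given locally by convergent real power series). $\mathbb{K}$ is the underlying field: $\mathbb{C}$ in cases (1), (2) and $\mathbb{R}$ in case (3), with its usual topology. $Z_f\subseteq\mathbb{K}$ is the zero set of $f$. $\mathcal{D}(\mathbb{K})$ is the collection of all closed discrete subsets of $\mathbb{K}$ together with the special member $\mathbb{K}$ itself. A discrete $z$-filter on $\mathbb{K}$ is a collection $\mathcal{F}$ of members of $\mathcal{D}(\mathbb{K})$ such that $\emptyset\notin\mathcal{F}$; $D_1,D_2\in\mathcal{F}$ implies $D_1\cap D_2\in\mathcal{F}$; and $D_1\in\mathcal{F}$, $D\in\mathcal{D}(\mathbb{K})$, $D_1\subseteq D$ imply $D\in\mathcal{F}$. A discrete $z$-ultrafilter is a discrete $z$-filter that is maximal under inclusion. $\theta\mathbb{K}$ is the set of all discrete $z$-ultrafilters on $\mathbb{K}$, regarded as an index set: $\mathcal{D}^p$ is the discrete $z$-ultrafilter corresponding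 to the point $p\in\theta\mathbb{K}$. It is topologized by taking as basic closed sets the sets $\overline{Z}=\{p\in\theta\mathbb{K}: Z\in\mathcal{D}^p\}$, for $Z$ a closed discrete subset of $\mathbb{K}$. The map $\eta_{\mathbb{K}}:\mathbb{K}\to\theta\mathbb{K}$ sends $a\in\mathbb{K}$ to the point of $\theta\mathbb{K}$ given by the discrete $z$-ultrafilter $\mathcal{D}_a$ fixed at $a$ (all of whose members contain $a$). Maximal ideals of $\mathbb{K}\langle z\rangle$ correspond to discrete $z$-ultrafilters on $\mathbb{K}$ via $M\mapsto Z[M]=\{Z_f:f\in M\}$, with inverse $\mathcal{F}\mapsto Z^{-1}[\mathcal{F}]=\{f\in\mathbb{K}\langle z\rangle: Z_f\in\mathcal{F}\}$; $M^p$ denotes the maximal ideal corresponding to $\mathcal{D}^p$. *)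

theory Defs
  imports "HOL-Analysis.Analysis"
begin

text \<open>The three rings, with pointwise operations. In the second one only the coefficients are
  real: its elements are entire functions on the complex plane, so zero sets are taken there.\<close>

definition entire_functions :: "(complex \<Rightarrow> complex) set" where
  "entire_functions = {f. f holomorphic_on UNIV}"

definition real_coeff_entire_functions :: "(complex \<Rightarrow> complex) set" where
  "real_coeff_entire_functions =
     {f. \<exists>a :: nat \<Rightarrow> real. \<forall>z. (\<lambda>n. of_real (a n) * z ^ n) sums f z}"

definition real_analytic_functions :: "(real \<Rightarrow> real) set" where
  "real_analytic_functions =
     {f. \<forall>x. \<exists>r > 0. \<exists>a :: nat \<Rightarrow> real. \<forall>y. \<bar>y - x\<bar> < r \<longrightarrow> (\<lambda>n. a n * (y - x) ^ n) sums f y}"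

definition zero_set :: "('a \<Rightarrow> 'a::zero) \<Rightarrow> 'a set" where
  "zero_set f = {z. f z = 0}"

definition closed_discrete :: "'a::topological_space set \<Rightarrow> bool" where
  "closed_discrete D \<longleftrightarrow> closed D \<and> discrete D"

text \<open>The collection \<open>\<D>(\<bbbK>)\<close>, with \<open>\<bbbK>\<close> the whole type.\<close>

definition DK :: "'a::topological_space set set" where
  "DK = insert UNIV {D. closed_discrete D}"

definition discrete_zfilter :: "'a::topological_space set set \<Rightarrow> bool" where
  "discrete_zfilter F \<longleftrightarrow>
     F \<subseteq> DK \<and> {} \<notin> F \<and>
     (\<forall>D1 \<in> F. \<forall>D2 \<in> F. D1 \<inter> D2 \<in> F) \<and>
     (\<forall>D1 \<in> F. \<forall>D \<in> DK. D1 \<subseteq> D \<longrightarrow> D \<in> F)"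

definition discrete_zultrafilter :: "'a::topological_space set set \<Rightarrow> bool" where
  "discrete_zultrafilter F \<longleftrightarrow>
     discrete_zfilter F \<and> (\<forall>G. discrete_zfilter G \<and> F \<subseteq> G \<longrightarrow> G = F)"

text \<open>The index set is taken to be the set of ultrafilters itself, so that \<open>\<D>\<^sup>p\<close> is \<open>p\<close>.\<close>

definition theta :: "'a::topological_space set set set" where
  "theta = {p. discrete_zultrafilter p}"

definition basic_closed :: "'a::topological_space set \<Rightarrow> 'a set set set" where
  "basic_closed Z = {p \<in> theta. Z \<in> p}"

text \<open>The topology whose basic closed sets are the sets \<open>basic_closed Z\<close>, described through their
  complements. Its underlying set is all of \<open>theta\<close>, since \<open>basic_closed {} = {}\<close>.\<close>

definition theta_topology :: "'a::topological_space set set topology" where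
  "theta_topology = topology_generated_by {theta - basic_closed Z | Z. closed_discrete Z}"

definition eta :: "'a::topological_space \<Rightarrow> 'a set set" where
  "eta a = {D \<in> DK. a \<in> D}"

text \<open>The maximal ideal \<open>M\<^sup>p = Z\<^sup>-\<^sup>1[\<D>\<^sup>p]\<close> of the function ring \<open>R\<close> that corresponds
  to the ultrafilter \<open>p\<close>.\<close>

definition max_ideal_at ::
    "('a \<Rightarrow> 'a) set \<Rightarrow> 'a::{topological_space,zero} set set \<Rightarrow> ('a \<Rightarrow> 'a) set" where
  "max_ideal_at R p = {f \<in> R. zero_set f \<in> p}"

end

theory Submission
  imports Defs "HOL-Complex_Analysis.Complex_Analysis"
begin

text \<open>
  All three rings enter the argument through one property of their members: a function that is
  locally the sum of a power series satisfies the identity theorem, so its zero set is either the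
  whole line or plane, or has no limit points (\<open>zero_set_in_DK\<close>). Thus every zero set
  belongs to \<open>\<D>(\<bbbK>)\<close>, and the theorem becomes the topological statement that, for
  \<open>Z\<close> in \<open>\<D>(\<bbbK>)\<close>, a point \<open>p\<close> lies in the closure of
  \<open>\<eta>(Z)\<close> exactly when \<open>Z\<close> is a member of the ultrafilter \<open>p\<close>
  (\<open>closure_eta_iff\<close>).

  If \<open>Z \<notin> p\<close>, then \<open>Z\<close> is closed and discrete, because the whole space
  belongs to every ultrafilter. The complement of \<open>basic_closed Z\<close> is then an open
  neighbourhood of \<open>p\<close>, and it misses \<open>\<eta>(Z)\<close> because each \<open>\<eta>(a)\<close> with
  \<open>a \<in> Z\<close> contains \<open>Z\<close>.

  Conversely, ultrafilters are prime (\<open>theta_prime\<close>), so the generating open sets are closed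
  under finite intersections and every open neighbourhood of \<open>p\<close> contains the complement of
  \<open>basic_closed W\<close> for some closed discrete \<open>W \<notin> p\<close>. If \<open>Z \<in> p\<close>, then
  \<open>Z\<close> is not contained in \<open>W\<close>, for otherwise \<open>W \<in> p\<close>; any
  \<open>a \<in> Z - W\<close> gives a point \<open>\<eta>(a)\<close> of the neighbourhood. This direction covers
  \<open>Z = \<bbbK>\<close>, the zero set of the zero function, without a separate argument.
\<close>

section \<open>Closed discrete sets\<close>

text \<open>Absence of limit points is visibly inherited by subsets and finite unions, which is less
  apparent for the two defining conditions.\<close>

lemma closed_discrete_iff_no_limpt: "closed_discrete D \<longleftrightarrow> (\<forall>x. \<not> x islimpt D)"
proof
  assume "closed_discrete D"
  then show "\<forall>x. \<not> x islimpt D"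
    unfolding closed_discrete_def closed_limpt discrete_def isolated_in_islimpt_iff by auto
next
  assume "\<forall>x. \<not> x islimpt D"
  then show "closed_discrete D"
    unfolding closed_discrete_def closed_limpt discrete_def isolated_in_islimpt_iff by simp
qed

lemma closed_discrete_subset: "closed_discrete D \<Longrightarrow> E \<subseteq> D \<Longrightarrow> closed_discrete E"
  unfolding closed_discrete_iff_no_limpt using islimpt_subset by blast

lemma closed_discrete_Un: "closed_discrete D \<Longrightarrow> closed_discrete E \<Longrightarrow> closed_discrete (D \<union> E)"
  unfolding closed_discrete_iff_no_limpt by (simp add: islimpt_Un)

lemma closed_discrete_empty: "closed_discrete {}"
  by (simp add: closed_discrete_iff_no_limpt)

lemma closed_discrete_singleton: "closed_discrete {a::'a::t1_space}"
  by (simp add: closed_discrete_iff_no_limpt islimpt_finite)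

lemma UNIV_in_DK: "UNIV \<in> DK"
  by (simp add: DK_def)

lemma closed_discrete_in_DK: "closed_discrete D \<Longrightarrow> D \<in> DK"
  by (simp add: DK_def)

lemma DK_Int: "D \<in> DK \<Longrightarrow> E \<in> DK \<Longrightarrow> D \<inter> E \<in> DK"
  unfolding DK_def using closed_discrete_subset[OF _ Int_lower1] by auto

section \<open>Ultrafilters\<close>

lemma theta_filter: "p \<in> theta \<Longrightarrow> discrete_zfilter p"
  by (simp add: theta_def discrete_zultrafilter_def)

lemma theta_maximal: "p \<in> theta \<Longrightarrow> discrete_zfilter G \<Longrightarrow> p \<subseteq> G \<Longrightarrow> G = p"
  by (simp add: theta_def discrete_zultrafilter_def)

lemma zfilter_subset_DK: "discrete_zfilter F \<Longrightarrow> D \<in> F \<Longrightarrow> D \<in> DK"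
  unfolding discrete_zfilter_def by (elim conjE) (erule (1) subsetD)

lemma zfilter_nonempty_member: "discrete_zfilter F \<Longrightarrow> D \<in> F \<Longrightarrow> D \<noteq> {}"
  unfolding discrete_zfilter_def by (elim conjE) (rule notI, simp)

lemma zfilter_Int: "discrete_zfilter F \<Longrightarrow> D \<in> F \<Longrightarrow> E \<in> F \<Longrightarrow> D \<inter> E \<in> F"
  by (simp add: discrete_zfilter_def)

lemma zfilter_superset:
  "discrete_zfilter F \<Longrightarrow> D \<in> F \<Longrightarrow> E \<in> DK \<Longrightarrow> D \<subseteq> E \<Longrightarrow> E \<in> F"
  unfolding discrete_zfilter_def by meson

text \<open>The empty collection is a filter by definition, but it is not maximal, since
  \<open>{UNIV}\<close> is a larger one.\<close>

lemma UNIV_in_theta: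
  assumes "p \<in> theta"
  shows "UNIV \<in> p"
proof (cases "p = {}")
  case True
  have "discrete_zfilter {UNIV :: 'a set}"
    by (auto simp: discrete_zfilter_def UNIV_in_DK)
  then show ?thesis
    using theta_maximal[OF assms] True by blast
next
  case False
  then show ?thesis
    using zfilter_superset[OF theta_filter[OF assms]] UNIV_in_DK by blast
qed

text \<open>If \<open>W\<close> met every member of \<open>p\<close>, then \<open>W\<close> together with \<open>p\<close> would
  generate a filter, which maximality forces to equal \<open>p\<close>.\<close>

lemma theta_disjoint_member:
  assumes p: "p \<in> theta" and W: "W \<in> DK" "W \<notin> p"
  obtains E where "E \<in> p" "E \<inter> W = {}"
proof (rule ccontr)
  assume "\<not> thesis"
  with that have meets: "E \<inter> W \<noteq> {}" if "E \<in> p" for E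
    using \<open>E \<in> p\<close> by blast
  note F = theta_filter[OF p]
  define G where "G = {D \<in> DK. \<exists>E\<in>p. E \<inter> W \<subseteq> D}"
  have "discrete_zfilter G"
    unfolding discrete_zfilter_def
  proof (intro conjI ballI impI)
    show "G \<subseteq> DK" by (auto simp: G_def)
    show "{} \<notin> G" using meets by (auto simp: G_def)
  next
    fix D1 D2 assume "D1 \<in> G" "D2 \<in> G"
    then obtain E1 E2 where D: "D1 \<in> DK" "D2 \<in> DK"
      and E: "E1 \<in> p" "E2 \<in> p" "E1 \<inter> W \<subseteq> D1" "E2 \<inter> W \<subseteq> D2"
      unfolding G_def by blast
    have "E1 \<inter> E2 \<in> p" by (rule zfilter_Int[OF F E(1,2)])
    moreover have "(E1 \<inter> E2) \<inter> W \<subseteq> D1 \<inter> D2" using E by blast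
    ultimately show "D1 \<inter> D2 \<in> G" unfolding G_def using DK_Int[OF D] by blast
  next
    fix D1 D assume "D1 \<in> G" "D \<in> DK" "D1 \<subseteq> D"
    then show "D \<in> G" unfolding G_def by blast
  qed
  moreover have "p \<subseteq> G"
    unfolding G_def using zfilter_subset_DK[OF F] by blast
  ultimately have "G = p" by (rule theta_maximal[OF p])
  moreover have "W \<in> G"
    unfolding G_def using W(1) UNIV_in_theta[OF p] by blast
  ultimately show False using W(2) by simp
qed

lemma theta_prime:
  assumes p: "p \<in> theta" and V: "V \<in> DK" "V \<notin> p" and W: "W \<in> DK" "W \<notin> p"
  shows "V \<union> W \<notin> p"
proof
  assume "V \<union> W \<in> p"
  note F = theta_filter[OF p]
  obtain D where D: "D \<in> p" "D \<inter> V = {}" by (rule theta_disjoint_member[OF p V])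
  obtain E where E: "E \<in> p" "E \<inter> W = {}" by (rule theta_disjoint_member[OF p W])
  have "(D \<inter> E) \<inter> (V \<union> W) \<in> p"
    using D(1) E(1) \<open>V \<union> W \<in> p\<close> zfilter_Int[OF F] by blast
  moreover have "(D \<inter> E) \<inter> (V \<union> W) = {}" using D(2) E(2) by blast
  ultimately show False using zfilter_nonempty_member[OF F] by metis
qed

text \<open>Maximality comes from the singleton \<open>{a}\<close>, which is itself a member: every set in a
  larger filter must meet it.\<close>

lemma eta_in_theta: "eta (a::'a::t1_space) \<in> theta"
proof -
  have filt: "discrete_zfilter (eta a)"
    by (auto simp: discrete_zfilter_def eta_def DK_Int)
  have "G = eta a" if G: "discrete_zfilter G" "eta a \<subseteq> G" for G
  proof
    have "{a} \<in> G"
      using G(2) closed_discrete_in_DK[OF closed_discrete_singleton] by (auto simp: eta_def)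
    then have "{a} \<inter> D \<noteq> {}" if "D \<in> G" for D
      using that zfilter_Int[OF G(1)] zfilter_nonempty_member[OF G(1)] by blast
    then show "G \<subseteq> eta a"
      using zfilter_subset_DK[OF G(1)] by (auto simp: eta_def)
  qed (rule G(2))
  with filt show ?thesis
    by (auto simp: theta_def discrete_zultrafilter_def)
qed

section \<open>Closures of embedded sets\<close>

lemma openin_compl_basic_closed:
  "closed_discrete Z \<Longrightarrow> openin theta_topology (theta - basic_closed Z)"
  unfolding theta_topology_def
  by (rule topology_generated_by_Basis, rule CollectI, intro exI[of _ Z] conjI refl)

lemma topspace_theta: "topspace theta_topology = (theta :: 'a::topological_space set set set)"
proof -
  have compl: "theta - basic_closed {} = (theta :: 'a set set set)"
    using zfilter_nonempty_member[OF theta_filter] by (auto simp: basic_closed_def)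
  have "openin theta_topology (theta :: 'a set set set)"
    using openin_compl_basic_closed[OF closed_discrete_empty[where 'a = 'a]] unfolding compl .
  then have "theta \<subseteq> topspace (theta_topology :: 'a set set topology)"
    by (rule openin_subset)
  moreover have "topspace theta_topology \<subseteq> (theta :: 'a set set set)"
    unfolding theta_topology_def topology_generated_by_topspace by auto
  ultimately show ?thesis by (rule subset_antisym[rotated])
qed

text \<open>The generators are a base: the complements given by \<open>V\<close> and \<open>W\<close>
  intersect in a set that contains the complement given by \<open>V \<union> W\<close>, and by primeness
  the latter is still a neighbourhood of \<open>p\<close>.\<close>

lemma theta_neighbourhood_base:
  assumes "openin theta_topology T" "p \<in> T" "p \<in> theta"
  shows "\<exists>W. closed_discrete W \<and> W \<notin> p \<and> theta - basic_closed W \<subseteq> T"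
proof -
  have "generate_topology_on {theta - basic_closed Z | Z. closed_discrete Z} T"
    using assms(1) unfolding theta_topology_def by (rule openin_topology_generated_by)
  then show ?thesis using assms(2)
  proof induction
    case (Int S T)
    then obtain V W where V: "closed_discrete V" "V \<notin> p" "theta - basic_closed V \<subseteq> S"
      and W: "closed_discrete W" "W \<notin> p" "theta - basic_closed W \<subseteq> T"
      by blast
    have "V \<union> W \<notin> p"
      using theta_prime[OF assms(3)] V W closed_discrete_in_DK by blast
    moreover have cd: "closed_discrete (V \<union> W)"
      by (rule closed_discrete_Un[OF V(1) W(1)])
    moreover have "q \<notin> basic_closed (V \<union> W) \<Longrightarrow> q \<notin> basic_closed V \<and> q \<notin> basic_closed W"
      if "q \<in> theta" for q
      using zfilter_superset[OF theta_filter[OF that]] closed_discrete_in_DK[OF cd]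
      by (auto simp: basic_closed_def that)
    ultimately show ?case using V(3) W(3) by blast
  next
    case (UN K)
    then show ?case by blast
  next
    case (Basis S)
    then show ?case by (auto simp: basic_closed_def assms(3))
  qed simp
qed

lemma closure_eta_iff:
  fixes Z :: "'a::t1_space set"
  assumes Z: "Z \<in> DK" and p: "p \<in> theta"
  shows "p \<in> theta_topology closure_of (eta ` Z) \<longleftrightarrow> Z \<in> p"
proof
  assume cl: "p \<in> theta_topology closure_of (eta ` Z)"
  show "Z \<in> p"
  proof (rule ccontr)
    assume "Z \<notin> p"
    then have "closed_discrete Z"
      using Z UNIV_in_theta[OF p] by (auto simp: DK_def)
    moreover have "p \<in> theta - basic_closed Z"
      using \<open>Z \<notin> p\<close> p by (simp add: basic_closed_def)
    ultimately obtain a where "a \<in> Z" "eta a \<in> theta - basic_closed Z"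
      using cl openin_compl_basic_closed unfolding in_closure_of by blast
    then show False using Z by (auto simp: basic_closed_def eta_def)
  qed
next
  assume "Z \<in> p"
  have "\<exists>y. y \<in> eta ` Z \<and> y \<in> T" if T: "p \<in> T" "openin theta_topology T" for T
  proof -
    obtain W where W: "closed_discrete W" "W \<notin> p" "theta - basic_closed W \<subseteq> T"
      using theta_neighbourhood_base[OF T(2,1) p] by blast
    have "\<not> Z \<subseteq> W"
      using \<open>Z \<in> p\<close> W(2) zfilter_superset[OF theta_filter[OF p]] closed_discrete_in_DK[OF W(1)]
      by blast
    then obtain a where "a \<in> Z" "a \<notin> W" by blast
    then have "eta a \<in> theta - basic_closed W"
      using eta_in_theta[of a] by (simp add: basic_closed_def eta_def)
    then show ?thesis using W(3) \<open>a \<in> Z\<close> by blast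
  qed
  then show "p \<in> theta_topology closure_of (eta ` Z)"
    using p by (auto simp: in_closure_of topspace_theta)
qed

section \<open>Zero sets of local power series\<close>

definition locally_power_series :: "('a \<Rightarrow> 'a::{real_normed_field,banach}) \<Rightarrow> bool" where
  "locally_power_series f \<longleftrightarrow>
     (\<forall>x. \<exists>r>0. \<exists>a. \<forall>y. norm (y - x) < r \<longrightarrow> (\<lambda>n. a n * (y - x) ^ n) sums f y)"

text \<open>This is the local form of the identity theorem: a power series with a nonzero coefficient
  has no zeros in a punctured neighbourhood of its centre.\<close>

lemma zero_near_limpt_of_zeros:
  assumes f: "locally_power_series f" and x: "x islimpt zero_set f"
  obtains r where "r > 0" "ball x r \<subseteq> zero_set f"
proof -
  obtain r a where r: "r > 0"
    and sums: "\<And>y. norm (y - x) < r \<Longrightarrow> (\<lambda>n. a n * (y - x) ^ n) sums f y"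
    using f unfolding locally_power_series_def by meson
  have freq: "\<exists>\<^sub>F y in at x. f y = 0"
    using x by (simp add: islimpt_conv_frequently_at zero_set_def)
  have "((\<lambda>h. f (x + h)) \<longlongrightarrow> a 0) (at 0)"
    by (rule powser_limit_0[OF r]) (use sums[of "x + _"] in simp)
  then have "(f \<longlongrightarrow> a 0) (at x)"
    by (simp add: LIM_offset_zero_iff)
  \<comment> \<open>Otherwise \<open>f\<close> would stay away from zero near \<open>x\<close>.\<close>
  then have "a 0 = 0"
    using freq tendsto_imp_eventually_ne by (auto simp: frequently_def)
  moreover have "f x = a 0"
    using sums[of x] r by (simp add: powser_sums_zero_iff)
  ultimately have fx: "f x = 0" by simp
  have "a m = 0" for m
  proof (rule ccontr)
    assume "a m \<noteq> 0"
    with \<open>a 0 = 0\<close> have "m > 0" by (cases m) auto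
    obtain s where "s > 0" "\<And>z. z \<in> cball x s - {x} \<Longrightarrow> f z \<noteq> 0"
      using powser_0_nonzero[OF r sums fx \<open>a m \<noteq> 0\<close> \<open>m > 0\<close>] by blast
    then have "\<forall>\<^sub>F z in at x. f z \<noteq> 0"
      unfolding eventually_at by (intro exI[of _ s]) (auto simp: dist_commute)
    then show False using freq by (simp add: frequently_def)
  qed
  then have "f y = 0" if "norm (y - x) < r" for y
    using sums[OF that] by (simp add: sums_0 sums_unique2)
  then have "ball x r \<subseteq> zero_set f"
    by (auto simp: zero_set_def dist_norm norm_minus_commute)
  with r show thesis by (rule that)
qed

text \<open>By the local form, the limit points of the zero set form an open set; they always form a
  closed one. Connectedness leaves only two possibilities.\<close>

lemma zero_set_in_DK:
  assumes f: "locally_power_series f"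
  shows "zero_set f \<in> DK"
proof -
  let ?L = "{x. x islimpt zero_set f}"
  have "open ?L"
    unfolding open_contains_ball
  proof
    fix x assume "x \<in> ?L"
    then obtain r where r: "r > 0" "ball x r \<subseteq> zero_set f"
      using zero_near_limpt_of_zeros[OF f] by blast
    have "y islimpt zero_set f" if "y \<in> ball x r" for y
    proof -
      have "y islimpt ball x r"
        using that by (simp add: open_imp_islimpt)
      then show ?thesis using islimpt_subset r(2) by blast
    qed
    then show "\<exists>e>0. ball x e \<subseteq> ?L" using r(1) by blast
  qed
  moreover have "closed ?L" by (rule closed_limpts)
  ultimately have "?L = {} \<or> ?L = UNIV"
    using clopen[of ?L] by blast
  then show ?thesis
  proof
    assume "?L = {}"
    then show ?thesis
      by (auto intro!: closed_discrete_in_DK simp: closed_discrete_iff_no_limpt)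
  next
    assume L: "?L = UNIV"
    have "x \<in> zero_set f" for x
    proof -
      have "x islimpt zero_set f" using L by blast
      then obtain r where "r > 0" "ball x r \<subseteq> zero_set f"
        by (rule zero_near_limpt_of_zeros[OF f])
      then show ?thesis by auto
    qed
    then have "zero_set f = UNIV" by blast
    then show ?thesis by (simp add: UNIV_in_DK)
  qed
qed

lemma entire_locally_power_series:
  assumes "f \<in> entire_functions"
  shows "locally_power_series f"
  unfolding locally_power_series_def
proof
  fix x
  have "f holomorphic_on ball x 1"
    using assms by (auto simp: entire_functions_def intro: holomorphic_on_subset)
  then have "\<forall>y. norm (y - x) < 1 \<longrightarrow> (\<lambda>n. (deriv ^^ n) f x / fact n * (y - x) ^ n) sums f y"
    using holomorphic_power_series by (auto simp: dist_norm norm_minus_commute)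
  then show "\<exists>r>0. \<exists>a. \<forall>y. norm (y - x) < r \<longrightarrow> (\<lambda>n. a n * (y - x) ^ n) sums f y"
    by (intro exI[of _ 1] conjI exI[of _ "\<lambda>n. (deriv ^^ n) f x / fact n"]) auto
qed

lemma real_coeff_entire_subset: "real_coeff_entire_functions \<subseteq> entire_functions"
proof
  fix f assume "f \<in> real_coeff_entire_functions"
  then obtain a :: "nat \<Rightarrow> real" where a: "\<And>z. (\<lambda>n. of_real (a n) * z ^ n) sums f z"
    unfolding real_coeff_entire_functions_def by blast
  have "f holomorphic_on ball 0 r" for r
    by (rule power_series_holomorphic[where a = "\<lambda>n. of_real (a n)"]) (use a in simp)
  then have "f holomorphic_on (\<Union>r. ball 0 r)"
    by (intro holomorphic_on_UN_open) auto
  moreover have "(\<Union>r. ball 0 r) = (UNIV :: complex set)"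
    using gt_ex by (auto simp: UNIV_I)
  ultimately show "f \<in> entire_functions" by (simp add: entire_functions_def)
qed

lemma real_analytic_locally_power_series:
  "f \<in> real_analytic_functions \<Longrightarrow> locally_power_series f"
  by (simp add: real_analytic_functions_def locally_power_series_def)

section \<open>Maximal ideals as closure conditions\<close>

lemma max_ideal_at_eq_closure:
  assumes "\<And>f. f \<in> R \<Longrightarrow> locally_power_series f" and "p \<in> theta"
  shows "max_ideal_at R p = {f \<in> R. p \<in> theta_topology closure_of (eta ` zero_set f)}"
  using closure_eta_iff[OF zero_set_in_DK assms(2)] assms(1) by (auto simp: max_ideal_at_def)

theorem theorem3p12:
  shows "(\<forall>p \<in> theta. max_ideal_at entire_functions p =
            {f \<in> entire_functions. p \<in> theta_topology closure_of (eta ` zero_set f)}) \<and>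
         (\<forall>p \<in> theta. max_ideal_at real_coeff_entire_functions p =
            {f \<in> real_coeff_entire_functions. p \<in> theta_topology closure_of (eta ` zero_set f)}) \<and>
         (\<forall>p \<in> theta. max_ideal_at real_analytic_functions p =
            {f \<in> real_analytic_functions. p \<in> theta_topology closure_of (eta ` zero_set f)})"
proof (intro conjI ballI max_ideal_at_eq_closure)
  show "locally_power_series f" if "f \<in> entire_functions" for f
    using that by (rule entire_locally_power_series)
  show "locally_power_series f" if "f \<in> real_coeff_entire_functions" for f
    using subsetD[OF real_coeff_entire_subset that] by (rule entire_locally_power_series)
  show "locally_power_series f" if "f \<in> real_analytic_functions" for f
    using that by (rule real_analytic_locally_power_series)
qed

end
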